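(* If $S$ is a finite regular semigroup, then every subdirect product in $\mathbb{Z}\times S$ is finitely generated (as a semigroup).
   Context: $\mathbb{Z}$ denotes the additive (semi)group of integers, and $\mathbb{Z}\times S$ is the direct product semigroup. A subdirect product in $\mathbb{Z}\times S$ is a subsemigroup $U\leq \mathbb{Z}\times S$ whose coordinate projections to $\mathbb{Z}$ and to $S$ are both surjective. A semigroup $S$ is regular if for every $x\in S$ there exists $y\in S$ with $xyx=x$. *)

theory Defs
  imports "HOL-Algebra.Elementary_Groups"
begin

text \<open>
  Semigroups are represented by the records of HOL-Algebra, so that its direct product
  \<open>G \<times>\<times> H\<close> and its additive group of integers \<open>integer_group\<close> can be used. Only the carrier
  and the multiplication matter: the field \<open>one\<close> is junk, and nothing is assumed about it.
\<close>

locale carrier_semigroup =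
  fixes G (structure)
  assumes m_closed: "\<lbrakk>x \<in> carrier G; y \<in> carrier G\<rbrakk> \<Longrightarrow> x \<otimes> y \<in> carrier G"
    and m_assoc: "\<lbrakk>x \<in> carrier G; y \<in> carrier G; z \<in> carrier G\<rbrakk>
          \<Longrightarrow> (x \<otimes> y) \<otimes> z = x \<otimes> (y \<otimes> z)"

locale regular_semigroup = carrier_semigroup +
  assumes regular: "x \<in> carrier G \<Longrightarrow> \<exists>y\<in>carrier G. x \<otimes> y \<otimes> x = x"

definition subsemigroup :: "'a set \<Rightarrow> ('a, 'b) monoid_scheme \<Rightarrow> bool" where
  "subsemigroup U G \<longleftrightarrow>
     U \<subseteq> carrier G \<and> (\<forall>x\<in>U. \<forall>y\<in>U. x \<otimes>\<^bsub>G\<^esub> y \<in> U)"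

inductive_set semigroup_generate :: "('a, 'b) monoid_scheme \<Rightarrow> 'a set \<Rightarrow> 'a set"
  for G and X where
    incl: "x \<in> X \<Longrightarrow> x \<in> semigroup_generate G X"
  | mult: "x \<in> semigroup_generate G X \<Longrightarrow> y \<in> semigroup_generate G X
             \<Longrightarrow> x \<otimes>\<^bsub>G\<^esub> y \<in> semigroup_generate G X"

definition finitely_generated_subsemigroup :: "'a set \<Rightarrow> ('a, 'b) monoid_scheme \<Rightarrow> bool" where
  "finitely_generated_subsemigroup U G \<longleftrightarrow>
     subsemigroup U G \<and> (\<exists>X. finite X \<and> X \<subseteq> U \<and> semigroup_generate G X = U)"

definition subdirect_product ::
    "('a \<times> 'b) set \<Rightarrow> ('a, 'c) monoid_scheme \<Rightarrow> ('b, 'd) monoid_scheme \<Rightarrow> bool" where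
  "subdirect_product U G H \<longleftrightarrow>
     subsemigroup U (G \<times>\<times> H) \<and> fst ` U = carrier G \<and> snd ` U = carrier H"

end

theory Submission
  imports Defs
begin

text \<open>
  For \<open>s \<in> S\<close> let \<open>U\<^sub>s = {n. (n, s) \<in> U}\<close>, choose \<open>y\<close> with \<open>s y s = s\<close> and put \<open>e = s y\<close>. Since
  \<open>e s = s\<close>, the set \<open>U\<^sub>s\<close> is invariant under translation by elements of \<open>U\<^sub>e\<close>; conversely, any
  \<open>m \<in> U\<^sub>y\<close> translates \<open>U\<^sub>s\<close> into \<open>U\<^sub>e\<close>. So if \<open>U\<^sub>e\<close> has a positive element \<open>d\<close>, then the nonnegative
  part of \<open>U\<^sub>s\<close> is covered by finitely many progressions with difference \<open>d\<close>, and otherwise it is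
  bounded above by \<open>-m\<close>, hence finite. The negative part is symmetric, so each fibre of \<open>U\<close> over \<open>S\<close>
  lies in a finitely generated subsemigroup.
\<close>

text \<open>Here \<open>A\<close>, \<open>E\<close> and \<open>m\<close> abstract the fibre over
  \<open>s\<close>, the fibre over \<open>e\<close> and one element of the fibre over
  \<open>y\<close>, so that only arithmetic in the integers remains.\<close>

lemma nonneg_part_finite_progressions:
  fixes A E :: "int set"
  assumes "E \<noteq> {}"
    and add: "\<And>d a. d \<in> E \<Longrightarrow> a \<in> A \<Longrightarrow> d + a \<in> A"
    and shift: "\<And>a. a \<in> A \<Longrightarrow> a + m \<in> E"
  obtains F d where "finite F" "F \<subseteq> A" "d \<in> E"
    "\<And>a. a \<in> A \<Longrightarrow> 0 \<le> a \<Longrightarrow> \<exists>f\<in>F. \<exists>n::nat. a = int n * d + f"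
proof (cases "\<exists>d\<in>E. 0 < d")
  case True
  then obtain d where d: "d \<in> E" "0 < d" by blast
  \<comment> \<open>The starting points: nonnegative elements of \<open>A\<close> that leave the
    nonnegative part of \<open>A\<close> when \<open>d\<close> is subtracted. Descending by
    \<open>d\<close> from any nonnegative element of \<open>A\<close> ends in
    \<open>F\<close>.\<close>
  define F where "F = {a \<in> A. 0 \<le> a \<and> (a - d \<in> A \<longrightarrow> a < d)}"
  have mult: "int n * d + a \<in> A" if "a \<in> A" for n a
    using that by (induction n) (auto simp: algebra_simps dest: add[OF d(1)])
  have not_less: False if "a \<in> F" "b \<in> F" "a mod d = b mod d" "a < b" for a b
  proof -
    have "d dvd b - a" using that(3) by (simp add: mod_eq_dvd_iff dvd_diff_commute)
    then obtain k where k: "b - a = d * k" by blast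
    have "0 < k" using k d(2) that(4) by (metis diff_gt_0_iff_gt zero_less_mult_pos)
    \<comment> \<open>Stopping one step short of \<open>b\<close>: \<open>k - 1\<close> steps from
      \<open>a\<close> stay in \<open>A\<close> and reach \<open>b - d\<close>, which is
      nonnegative, contrary to \<open>b\<close> being in \<open>F\<close>. So \<open>F\<close> has
      at most one element per residue class modulo \<open>d\<close>.\<close>
    then have "b - d = int (nat (k - 1)) * d + a" using k by (simp add: algebra_simps)
    moreover have "0 \<le> int (nat (k - 1)) * d" using d(2) by simp
    ultimately show False using mult[of a "nat (k - 1)"] that unfolding F_def by auto
  qed
  have "inj_on (\<lambda>a. a mod d) F"
    by (rule inj_onI) (metis not_less linorder_less_linear)
  moreover have "(\<lambda>a. a mod d) ` F \<subseteq> {0..<d}" using d(2) by auto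
  ultimately have "finite F" by (meson finite_atLeastLessThan_int inj_on_finite)
  moreover have "\<exists>f\<in>F. \<exists>n::nat. a = int n * d + f" if "a \<in> A" "0 \<le> a" for a
    using that
  proof (induction "nat a" arbitrary: a rule: less_induct)
    case less
    show ?case
    proof (cases "a \<in> F")
      case True
      then show ?thesis by (intro bexI[of _ a] exI[of _ 0]) auto
    next
      case False
      then have "a - d \<in> A" "0 \<le> a - d" using less.prems unfolding F_def by auto
      then obtain f n where "f \<in> F" "a - d = int n * d + f"
        using less.hyps[of "a - d"] d(2) by auto
      then show ?thesis by (intro bexI[of _ f] exI[of _ "Suc n"]) (auto simp: algebra_simps)
    qed
  qed
  moreover have "F \<subseteq> A" by (auto simp: F_def)
  ultimately show ?thesis using d(1) that by blast
next
  case False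
  \<comment> \<open>Any \<open>d\<close> will do: the nonnegative part of \<open>A\<close> is
    finite, and each of its elements is its own starting point with \<open>n = 0\<close>.\<close>
  obtain d where "d \<in> E" using assms(1) by blast
  have "a \<le> -m" if "a \<in> A" for a using False shift[OF that] by force
  then have "A \<inter> {0..} \<subseteq> {0..-m}" by auto
  then have "finite (A \<inter> {0..})" using finite_subset by blast
  moreover have "\<exists>f\<in>A \<inter> {0..}. \<exists>n::nat. a = int n * d + f" if "a \<in> A" "0 \<le> a" for a
    using that by (intro bexI[of _ a] exI[of _ 0]) auto
  ultimately show ?thesis using \<open>d \<in> E\<close> that[of "A \<inter> {0..}" d] by blast
qed

text \<open>The one-sided result is applied to \<open>A\<close>, \<open>E\<close>, \<open>m\<close>
  and to their negatives. Negating back turns the difference \<open>d'\<close> into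
  \<open>- d'\<close>, so two differences suffice for all of \<open>A\<close>.\<close>

lemma finite_progressions:
  fixes A E :: "int set"
  assumes "E \<noteq> {}"
    and add: "\<And>d a. d \<in> E \<Longrightarrow> a \<in> A \<Longrightarrow> d + a \<in> A"
    and shift: "\<And>a. a \<in> A \<Longrightarrow> a + m \<in> E"
  obtains F D where "finite F" "F \<subseteq> A" "finite D" "D \<subseteq> E"
    "\<And>a. a \<in> A \<Longrightarrow> \<exists>f\<in>F. \<exists>d\<in>D. \<exists>n::nat. a = int n * d + f"
proof -
  obtain F d where F: "finite F" "F \<subseteq> A" "d \<in> E"
    "\<And>a. a \<in> A \<Longrightarrow> 0 \<le> a \<Longrightarrow> \<exists>f\<in>F. \<exists>n::nat. a = int n * d + f"
    using nonneg_part_finite_progressions[OF assms] by metis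
  have neg_add: "d + a \<in> uminus ` A" if de: "d \<in> uminus ` E" and aA: "a \<in> uminus ` A" for d a
  proof -
    have "- d + - a \<in> A" using de aA add by auto
    then show ?thesis by (intro image_eqI[of _ _ "- d + - a"]) auto
  qed
  have neg_shift: "a + - m \<in> uminus ` E" if "a \<in> uminus ` A" for a
  proof -
    have "- a + m \<in> E" using that shift[of "- a"] by auto
    then show ?thesis by (intro image_eqI[of _ _ "- a + m"]) auto
  qed
  have "uminus ` E \<noteq> {}" using assms(1) by simp
  then obtain F' d' where F': "finite F'" "F' \<subseteq> uminus ` A" "d' \<in> uminus ` E"
    "\<And>a. a \<in> uminus ` A \<Longrightarrow> 0 \<le> a \<Longrightarrow> \<exists>f\<in>F'. \<exists>n::nat. a = int n * d' + f"
    using nonneg_part_finite_progressions[OF _ neg_add neg_shift] by metis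
  have "\<exists>f\<in>F \<union> uminus ` F'. \<exists>c\<in>{d, - d'}. \<exists>n::nat. a = int n * c + f" if "a \<in> A" for a
  proof (cases "0 \<le> a")
    case True
    then show ?thesis using F(4)[OF that] by blast
  next
    case False
    then obtain f n where "f \<in> F'" "- a = int n * d' + f" using F'(4)[OF imageI[OF \<open>a \<in> A\<close>]] by auto
    then have "- f \<in> F \<union> uminus ` F'" "a = int n * - d' + - f" by auto
    then show ?thesis by blast
  qed
  moreover have "finite (F \<union> uminus ` F')" "F \<union> uminus ` F' \<subseteq> A" "{d, - d'} \<subseteq> E"
    using F(1-3) F'(1-3) by auto
  ultimately show ?thesis using that[of "F \<union> uminus ` F'" "{d, - d'}"] by blast
qed

lemma semigroup_generate_mono:
  assumes "X \<subseteq> Y"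
  shows "semigroup_generate G X \<subseteq> semigroup_generate G Y"
proof
  fix x assume "x \<in> semigroup_generate G X"
  then show "x \<in> semigroup_generate G Y"
    by induction (use assms in \<open>auto intro: semigroup_generate.intros\<close>)
qed

lemma semigroup_generate_subset:
  assumes "subsemigroup U G" "X \<subseteq> U"
  shows "semigroup_generate G X \<subseteq> U"
proof
  fix x assume "x \<in> semigroup_generate G X"
  then show "x \<in> U"
    by induction (use assms in \<open>auto simp: subsemigroup_def\<close>)
qed

text \<open>Since \<open>e\<close> fixes \<open>s\<close> from the left, multiplying
  \<open>(f, s)\<close> on the left \<open>n\<close> times by \<open>(d, e)\<close> gives
  \<open>(n * d + f, s)\<close>. A progression in the fibre over \<open>s\<close> is thus generated
  by two elements of \<open>U\<close>, one of which may lie in the fibre over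
  \<open>e\<close>.\<close>

lemma finite_generation_of_fibre:
  assumes "regular_semigroup S"
    and U: "subsemigroup U (integer_group \<times>\<times> S)" and proj: "snd ` U = carrier S"
    and s: "s \<in> carrier S"
  shows "\<exists>X. finite X \<and> X \<subseteq> U \<and>
           (\<forall>n. (n, s) \<in> U \<longrightarrow> (n, s) \<in> semigroup_generate (integer_group \<times>\<times> S) X)"
proof -
  interpret regular_semigroup S by fact
  let ?G = "integer_group \<times>\<times> S"
  obtain y where y: "y \<in> carrier S" "s \<otimes>\<^bsub>S\<^esub> y \<otimes>\<^bsub>S\<^esub> s = s" using regular[OF s] by blast
  define e where "e = s \<otimes>\<^bsub>S\<^esub> y"
  have es: "e \<otimes>\<^bsub>S\<^esub> s = s" and e: "e \<in> carrier S"
    using y s m_closed by (auto simp: e_def)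
  obtain m where m: "(m, y) \<in> U" using proj y(1) by force
  have mult: "(i + j, a \<otimes>\<^bsub>S\<^esub> b) \<in> U" if "(i, a) \<in> U" "(j, b) \<in> U" for i j a b
    using U that by (force simp: subsemigroup_def)
  \<comment> \<open>The next three facts are the hypotheses of \<open>finite_progressions\<close>:
    surjectivity onto \<open>S\<close>, then \<open>e s = s\<close>, then
    \<open>s y = e\<close>.\<close>
  have nonempty: "{n. (n, e) \<in> U} \<noteq> {}" using proj e by force
  have add: "d + a \<in> {n. (n, s) \<in> U}" if "d \<in> {n. (n, e) \<in> U}" "a \<in> {n. (n, s) \<in> U}" for d a
    using mult[of d e a s] that es by simp
  have shift: "a + m \<in> {n. (n, e) \<in> U}" if "a \<in> {n. (n, s) \<in> U}" for a
    using mult[of a s m y] that m by (simp add: e_def)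
  obtain F D where FD: "finite F" "F \<subseteq> {n. (n, s) \<in> U}" "finite D" "D \<subseteq> {n. (n, e) \<in> U}"
    "\<And>a. a \<in> {n. (n, s) \<in> U} \<Longrightarrow> \<exists>f\<in>F. \<exists>d\<in>D. \<exists>n::nat. a = int n * d + f"
    using finite_progressions[OF nonempty add shift] by metis
  define X where "X = F \<times> {s} \<union> D \<times> {e}"
  have "(int n * d + f, s) \<in> semigroup_generate ?G X" if "f \<in> F" "d \<in> D" for f d n
  proof (induction n)
    case 0
    then show ?case using that by (auto simp: X_def intro: semigroup_generate.incl)
  next
    case (Suc n)
    have "(d, e) \<in> semigroup_generate ?G X"
      using that by (auto simp: X_def intro: semigroup_generate.incl)
    from semigroup_generate.mult[OF this Suc] show ?case
      by (simp add: es algebra_simps)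
  qed
  then have "(n, s) \<in> semigroup_generate ?G X" if "(n, s) \<in> U" for n
    using FD(5)[of n] that by auto
  moreover have "finite X" "X \<subseteq> U" using FD by (auto simp: X_def)
  ultimately show ?thesis by blast
qed

theorem theorem3p1:
  fixes S :: "('a, 'b) monoid_scheme"
  assumes "regular_semigroup S"
    and "finite (carrier S)"
  shows "\<forall>U. subdirect_product U integer_group S \<longrightarrow>
           finitely_generated_subsemigroup U (integer_group \<times>\<times> S)"
proof (intro allI impI)
  fix U assume "subdirect_product U integer_group S"
  then have U: "subsemigroup U (integer_group \<times>\<times> S)" and proj: "snd ` U = carrier S"
    by (auto simp: subdirect_product_def)
  let ?gen = "semigroup_generate (integer_group \<times>\<times> S)"
  obtain X where X: "\<And>s. s \<in> carrier S \<Longrightarrow>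
      finite (X s) \<and> X s \<subseteq> U \<and> (\<forall>n. (n, s) \<in> U \<longrightarrow> (n, s) \<in> ?gen (X s))"
    using finite_generation_of_fibre[OF assms(1) U proj] by metis
  \<comment> \<open>Finiteness of \<open>S\<close> enters here: there are only finitely many fibres,
    so their generating sets have a finite union.\<close>
  define Y where "Y = (\<Union>s\<in>carrier S. X s)"
  have "finite Y" "Y \<subseteq> U" using X assms(2) by (auto simp: Y_def)
  moreover have "U \<subseteq> ?gen Y"
  proof (rule subrelI)
    fix n s assume ns: "(n, s) \<in> U"
    then have s: "s \<in> carrier S" using proj by force
    then have "X s \<subseteq> Y" by (auto simp: Y_def)
    then show "(n, s) \<in> ?gen Y" using X[OF s] ns semigroup_generate_mono by blast
  qed
  ultimately show "finitely_generated_subsemigroup U (integer_group \<times>\<times> S)"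
    using U semigroup_generate_subset[OF U \<open>Y \<subseteq> U\<close>]
    by (auto simp: finitely_generated_subsemigroup_def)
qed

end
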